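(* For every positive integer $d_1$ and arbitrary $d_2$ (that is, with $d_2$ considered as a formal variable), the following identity holds, with $q$ a formal variable: $$ \sum_{m\ge 1}\ \sum_{(k_1,\dots,k_m;\,n_1,\dots,n_m)} \begin{bmatrix} d_2\\ \sum_{j=1}^m k_j\end{bmatrix}_q\ \prod_{i=1}^m \begin{bmatrix} d_2+2d_1+2\sum_{j=1}^{i}(n_i-n_j)k_j\\ k_i\end{bmatrix}_q =\frac{[2d_1+d_2]_q}{[d_2]_q}\begin{bmatrix} d_1+d_2-1\\ d_1\end{bmatrix}_q^2 , $$ where, for each $m\ge 1$, the inner sum runs over all integers $k_1,\dots,k_m>0$ and all integers $n_1>n_2>\dots>n_m>0$ such that $$n_1k_1+\dots+n_mk_m=d_1 .$$ (For $i=1$ the factor in the product is $\begin{bmatrix} d_2+2d_1\\ k_1\end{bmatrix}_q$. For fixed $d_1$ the whole sum is finite.)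
   Context: The $q$-integers are defined symmetrically by $[\alpha]_q:=q^{\alpha/2}-q^{-\alpha/2}$. For an integer $k\ge 0$ and a (possibly formal) upper parameter $\alpha$, the $q$-binomial coefficient is $$\begin{bmatrix} \alpha\\k\end{bmatrix}_q:=\frac{[\alpha]_q[\alpha-1]_q\cdots[\alpha-k+1]_q}{[k]_q[k-1]_q\cdots[1]_q}$$ (equal to $1$ for $k=0$). When $\alpha$ is a nonnegative integer with $k>\alpha$ this is $0$. Here $q$ (more precisely $q^{1/2}$) is a formal variable, and treating $d_2$ as a formal variable means that $X:=q^{d_2/2}$ is regarded as an indeterminate independent of $q$, so that $[d_2+a]_q=Xq^{a/2}-X^{-1}q^{-a/2}$ for every integer $a$; the identity is then an identity of rational functions in $X$ and $q^{1/2}$. *)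

theory Defs
  imports
    "HOL-Computational_Algebra.Polynomial"
    "HOL-Computational_Algebra.Fraction_Field"
begin

text \<open>
  We work in the field of rational functions \<open>\<rat>(s, X)\<close> in two independent indeterminates, realised
  as the fraction field of \<open>\<rat>[s][X]\<close>. Here \<open>s\<close> plays the role of \<open>q\<^sup>1\<^sup>/\<^sup>2\<close> and \<open>X\<close> the role
  of \<open>q\<close> to the power \<open>d\<^sub>2/2\<close>, with \<open>d\<^sub>2\<close> a formal variable.
\<close>

type_synonym ratfun = "rat poly poly fract"

definition q_half :: ratfun where
  "q_half = Fract [:[:0, 1:]:] 1"

definition X :: ratfun where
  "X = Fract [:0, 1:] 1"

text \<open>
  The parameters \<open>\<alpha>\<close> that occur are \<open>\<alpha> = c d\<^sub>2 + a\<close> with integers \<open>c\<close>, \<open>a\<close>. They are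
  represented by the two coefficients: \<open>c = 0\<close> gives the ordinary integers, \<open>c = 1\<close> the formal
  parameters \<open>d\<^sub>2 + a\<close>.
\<close>

definition q_int :: "int \<Rightarrow> int \<Rightarrow> ratfun" where
  "q_int c a = X powi c * q_half powi a - X powi (- c) * q_half powi (- a)"

definition q_binomial :: "int \<Rightarrow> int \<Rightarrow> nat \<Rightarrow> ratfun" where
  "q_binomial c a k = (\<Prod>i<k. q_int c (a - int i)) / (\<Prod>i=1..k. q_int 0 (int i))"

text \<open>
  Lists are indexed from 0, so \<open>k ! i\<close> and \<open>n ! i\<close> are \<open>k\<^sub>i\<^sub>+\<^sub>1\<close> and \<open>n\<^sub>i\<^sub>+\<^sub>1\<close>.
\<close>

definition index_set :: "nat \<Rightarrow> (nat \<times> nat list \<times> nat list) set" where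
  "index_set d = {(m, k, n). m \<ge> 1 \<and> length k = m \<and> length n = m \<and>
     (\<forall>i<m. k ! i > 0) \<and> (\<forall>i<m. n ! i > 0) \<and>
     (\<forall>i j. i < j \<and> j < m \<longrightarrow> n ! i > n ! j) \<and>
     (\<Sum>i<m. n ! i * k ! i) = d}"

text \<open>
  Finiteness matters because a sum over an infinite set is 0 by convention.
\<close>

lemma finite_index_set: "finite (index_set d)"
proof (rule finite_subset)
  let ?L = "{xs :: nat list. set xs \<subseteq> {..d} \<and> length xs \<le> d}"
  show "index_set d \<subseteq> {..d} \<times> ?L \<times> ?L"
  proof
    fix x assume "x \<in> index_set d"
    then obtain m k n where x: "x = (m, k, n)" and l: "length k = m" "length n = m"
      and pos: "\<And>i. i < m \<Longrightarrow> k ! i > 0" "\<And>i. i < m \<Longrightarrow> n ! i > 0"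
      and s: "(\<Sum>i<m. n ! i * k ! i) = d"
      by (auto simp: index_set_def)
    have "(\<Sum>i<m. 1) \<le> (\<Sum>i<m. n ! i * k ! i)"
      using pos by (intro sum_mono) (simp add: Suc_le_eq)
    then have m: "m \<le> d" using s by simp
    have le: "n ! i * k ! i \<le> d" if "i < m" for i
      using member_le_sum[of i "{..<m}" "\<lambda>i. n ! i * k ! i"] s that by simp
    have "n ! i \<le> d" "k ! i \<le> d" if "i < m" for i
    proof -
      have "n ! i * 1 \<le> n ! i * k ! i" "1 * k ! i \<le> n ! i * k ! i"
        using pos[OF that] by (intro mult_le_mono; simp)+
      then show "n ! i \<le> d" "k ! i \<le> d" using le[OF that] by linarith+
    qed
    then have "set k \<subseteq> {..d}" "set n \<subseteq> {..d}"
      using l by (auto simp: in_set_conv_nth)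
    then show "x \<in> {..d} \<times> ?L \<times> ?L"
      using x l m by simp
  qed
  show "finite ({..d} \<times> ?L \<times> ?L)"
    by (intro finite_cartesian_product finite_lists_length_le) simp_all
qed

end

theory Submission imports Defs begin

text \<open>
  A pair of sequences \<open>n\<^sub>1 > \<dots> > n\<^sub>m > 0\<close> and \<open>k\<^sub>1, \<dots>, k\<^sub>m > 0\<close> with
  \<open>\<Sum>n\<^sub>ik\<^sub>i = D\<close> is a partition of \<open>D\<close> into \<open>K = \<Sum>k\<^sub>i\<close> parts, where the part \<open>n\<^sub>i\<close> occurs
  \<open>k\<^sub>i\<close> times. The first factor of the summand depends on \<open>K\<close> alone, so the multisum can be
  evaluated in two steps: for fixed \<open>K\<close> first, and over \<open>K\<close> afterwards.

  Write \<open>H(A, D, K)\<close> for the sum of the products over \<open>i\<close>, with \<open>A\<close> in place of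
  \<open>d\<^sub>2 + 2d\<^sub>1\<close>. These products involve only the differences \<open>n\<^sub>i - n\<^sub>j\<close>, so they do not
  change when all parts are lowered by one, that is, when the first column of the Young diagram is
  removed. If \<open>c\<close> of the parts are equal to one, these disappear, and they account for exactly one
  factor, whose upper parameter is \<open>A - 2(D - K)\<close>. Therefore
  \<open>H(A, D, K) = \<Sum>\<^sub>c binom(A - 2(D - K), c) H(A, D - K, K - c)\<close> (lemma \<open>sum_weight_rec\<close>). This
  recursion has the closed solution
  \<open>H(A, D, K) = [A]/[K] binom(D - 1, K - 1) binom(A - D + K - 1, K - 1)\<close> for positive
  \<open>D\<close> and \<open>K\<close> (lemma \<open>sum_weight\<close>).

  Both the induction step for this closed form and the remaining sum over \<open>K\<close> are instances of a
  single summation formula, \<open>q_binomial_sum\<close>, with the formal variable contained in its parameter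
  \<open>e\<close> in the former and in \<open>x\<close> in the latter. That formula is a case of the q-Saalschuetz theorem,
  which is proved in a form where no parameter occurs in a denominator (lemma \<open>q_saalschuetz\<close>), by
  induction on the number of terms.
\<close>

section \<open>Arithmetic of the symmetric q-integers\<close>

lemma q_half_nonzero: "q_half \<noteq> 0"
  by (simp add: q_half_def Zero_fract_def eq_fract)

lemma X_nonzero: "X \<noteq> 0"
  by (simp add: X_def Zero_fract_def eq_fract)

definition q_cosh :: "int \<Rightarrow> int \<Rightarrow> ratfun" where
  "q_cosh c a = X powi c * q_half powi a + X powi (- c) * q_half powi (- a)"

text \<open>
  A q-integer is a hyperbolic sine up to scaling, and this is the formula
  \<open>2 sinh x sinh y = cosh (x + y) - cosh (x - y)\<close>. It turns every quadratic relation between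
  q-integers used below into a cancellation of terms.
\<close>

lemma q_int_mult:
  "q_int c a * q_int c' a' = q_cosh (c + c') (a + a') - q_cosh (c - c') (a - a')"
  using q_half_nonzero X_nonzero
  by (simp add: q_int_def q_cosh_def power_int_add power_int_diff power_int_minus field_simps)

lemma q_int_0_0 [simp]: "q_int 0 0 = 0"
  by (simp add: q_int_def)

text \<open>
  If \<open>[k] = 0\<close>, then \<open>q\<^sup>k = 1\<close>, which a comparison of degrees excludes.
\<close>

lemma q_int_nat_nonzero:
  assumes "k > 0"
  shows "q_int 0 (int k) \<noteq> 0"
proof
  assume "q_int 0 (int k) = 0"
  then have "q_half ^ k = inverse (q_half ^ k)"
    by (simp add: q_int_def power_int_minus)
  then have "q_half ^ k * q_half ^ k = 1"
    using q_half_nonzero by (metis power_not_zero right_inverse)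
  then have "q_half ^ (2 * k) = 1"
    by (simp add: mult_2 power_add)
  moreover have "q_half ^ j = Fract ([:[:0, 1:]:] ^ j) 1" for j
    by (induction j) (simp_all add: q_half_def One_fract_def)
  ultimately have "[:[:0, 1:]:] ^ (2 * k) = (1 :: rat poly poly)"
    by (simp add: One_fract_def eq_fract)
  moreover have "[:[:0, 1:]:] ^ j = ([:[:0, 1:] ^ j:] :: rat poly poly)" for j
    by (induction j) (simp_all add: one_pCons)
  ultimately have "[:0, 1:] ^ (2 * k) = (1 :: rat poly)"
    by (simp add: one_pCons)
  then have "degree ([:0, 1:] ^ (2 * k) :: rat poly) = 0"
    by simp
  then show False
    using assms by (simp add: degree_power_eq)
qed

definition q_fact :: "nat \<Rightarrow> ratfun" where
  "q_fact n = (\<Prod>i=1..n. q_int 0 (int i))"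

definition q_rising :: "int \<Rightarrow> int \<Rightarrow> nat \<Rightarrow> ratfun" where
  "q_rising c a n = (\<Prod>i<n. q_int c (a + int i))"

lemma q_fact_0 [simp]: "q_fact 0 = 1"
  by (simp add: q_fact_def)

lemma q_fact_Suc: "q_fact (Suc n) = q_int 0 (int (Suc n)) * q_fact n"
  by (simp add: q_fact_def)

lemma q_fact_nonzero: "q_fact n \<noteq> 0"
  using q_int_nat_nonzero by (auto simp: q_fact_def)

lemma q_rising_0 [simp]: "q_rising c a 0 = 1"
  by (simp add: q_rising_def)

lemma q_rising_Suc: "q_rising c a (Suc n) = q_rising c a n * q_int c (a + int n)"
  by (simp add: q_rising_def)

lemma q_rising_Suc_left: "q_rising c a (Suc n) = q_int c a * q_rising c (a + 1) n"
  unfolding q_rising_def prod.lessThan_Suc_shift by (simp add: algebra_simps)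

lemma q_rising_eq_q_binomial: "q_rising c a n = q_fact n * q_binomial c (a + int n - 1) n"
proof -
  have "q_rising c a n = (\<Prod>i<n. q_int c (a + int n - 1 - int i))"
    unfolding q_rising_def
    by (rule prod.reindex_bij_witness[where i = "\<lambda>i. n - 1 - i" and j = "\<lambda>i. n - 1 - i"])
      (auto simp: of_nat_diff algebra_simps)
  then show ?thesis
    using q_fact_nonzero[of n] by (simp add: q_binomial_def q_fact_def)
qed

lemma q_fact_mult_q_rising: "q_fact k * q_rising 0 (int k + 1) n = q_fact (k + n)"
  by (induction n) (simp_all add: q_rising_Suc q_fact_Suc algebra_simps)

lemma q_binomial_0 [simp]: "q_binomial c a 0 = 1"
  by (simp add: q_binomial_def)

lemma q_binomial_absorb:
  "q_int 0 (int (Suc k)) * q_binomial c a (Suc k) = q_int c a * q_binomial c (a - 1) k"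
proof -
  have "(\<Prod>i<Suc k. q_int c (a - int i)) = q_int c a * (\<Prod>i<k. q_int c (a - 1 - int i))"
    unfolding prod.lessThan_Suc_shift by (simp add: algebra_simps)
  then show ?thesis
    using q_int_nat_nonzero[of "Suc k"] by (simp add: q_binomial_def)
qed

lemma q_binomial_Suc:
  "q_int 0 (int (Suc k)) * q_binomial c a (Suc k) = q_int c (a - int k) * q_binomial c a k"
  using q_int_nat_nonzero[of "Suc k"] by (simp add: q_binomial_def)

lemma q_binomial_eq_q_fact:
  assumes "k \<le> n"
  shows "q_binomial 0 (int n) k = q_fact n / (q_fact k * q_fact (n - k))"
  using q_fact_mult_q_rising[of "n - k" k] assms q_fact_nonzero[of k] q_fact_nonzero[of "n - k"]
  by (simp add: q_rising_eq_q_binomial of_nat_diff field_simps)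

lemma q_binomial_eq_0:
  assumes "n < k"
  shows "q_binomial 0 (int n) k = 0"
proof -
  have "(\<Prod>i<k. q_int 0 (int n - int i)) = 0"
    using assms by (auto intro!: bexI[of _ n])
  then show ?thesis
    by (simp add: q_binomial_def)
qed

section \<open>The q-Saalschuetz summation\<close>

text \<open>
  The parameters \<open>a\<close>, \<open>b\<close>, \<open>e\<close> may each involve multiples \<open>c1\<close>, \<open>c2\<close>, \<open>c3\<close> of the formal
  variable; the balancing condition of the theorem is built into the upper parameter
  \<open>f = b - a - e\<close> of the last factor. Write \<open>S\<^sub>n(a, b, e)\<close> for the left-hand side. The relation
  \<open>[n + 1][f + k] = [f][n + 1 - k] + [f + n + 1][k]\<close> splits the summand, and absorbing \<open>[n + 1 - k]\<close>
  and \<open>[k]\<close> into the binomial coefficients yields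
  \<open>[n + 1] S\<^sub>n\<^sub>+\<^sub>1(a, b, e) = [f][e] S\<^sub>n(a, b, e - 1) + [a][b] S\<^sub>n(a - 1, b + 1, e)\<close>.
  By the induction hypothesis the two sums on the right have the same value, and their coefficients
  add up to \<open>[b - e][a + e]\<close>.
\<close>

lemma q_saalschuetz:
  "(\<Sum>k\<le>n. q_binomial c1 a k * q_binomial c3 e (n - k) * q_rising c2 b k *
       q_rising (c2 - c1 - c3) (b - a - e + int k) (n - k))
   = q_rising (c2 - c3) (b - e) n * q_binomial (c1 + c3) (a + e) n"
proof (induction n arbitrary: a b e)
  case 0
  show ?case by simp
next
  case (Suc n)
  define f where "f = b - a - e"
  define cf where "cf = c2 - c1 - c3"
  let ?B = "\<lambda>k. q_binomial c1 a k * q_binomial c3 e (Suc n - k) * q_rising c2 b k"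
  define U where "U k = q_int cf f * q_int 0 (int (Suc n) - int k) * ?B k *
    q_rising cf (f + int k + 1) (n - k)" for k
  define V where "V k = q_int 0 (int k) * ?B k * q_rising cf (f + int k + 1) (Suc n - k)" for k
  have term_split: "q_int 0 (int (Suc n)) * (?B k * q_rising cf (f + int k) (Suc n - k))
      = U k + V k" if "k \<le> Suc n" for k
  proof (cases "k = Suc n")
    case True
    then show ?thesis by (simp add: U_def V_def)
  next
    case False
    then have k: "Suc n - k = Suc (n - k)" and kn: "int (n - k) = int n - int k"
      using that by auto
    have L: "q_rising cf (f + int k) (Suc n - k)
        = q_int cf (f + int k) * q_rising cf (f + int k + 1) (n - k)"
      unfolding k by (rule q_rising_Suc_left)
    have R: "q_rising cf (f + int k + 1) (Suc n - k)
        = q_rising cf (f + int k + 1) (n - k) * q_int cf (f + int (Suc n))"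
      unfolding k q_rising_Suc kn by (simp add: algebra_simps)
    have pascal: "q_int cf (f + int k) * q_int 0 (int (Suc n))
        = q_int cf f * q_int 0 (int (Suc n) - int k) + q_int cf (f + int (Suc n)) * q_int 0 (int k)"
      unfolding q_int_mult by (simp add: algebra_simps)
    have "q_int 0 (int (Suc n)) * (?B k * q_rising cf (f + int k) (Suc n - k))
        = (q_int cf (f + int k) * q_int 0 (int (Suc n))) *
          (?B k * q_rising cf (f + int k + 1) (n - k))"
      unfolding L by (simp only: mult_ac)
    also have "\<dots> = U k + V k"
      unfolding pascal U_def V_def R distrib_right by (simp only: mult_ac)
    finally show ?thesis .
  qed
  have sum_U: "(\<Sum>k\<le>Suc n. U k) = q_int cf f * q_int c3 e *
      (q_rising (c2 - c3) (b - e + 1) n * q_binomial (c1 + c3) (a + e - 1) n)"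
  proof -
    have U: "U k = q_int cf f * q_int c3 e * (q_binomial c1 a k * q_binomial c3 (e - 1) (n - k) *
        q_rising c2 b k * q_rising (c2 - c1 - c3) (b - a - (e - 1) + int k) (n - k))"
      if "k \<le> n" for k
    proof -
      have "q_int 0 (int (Suc n) - int k) * q_binomial c3 e (Suc n - k)
          = q_int c3 e * q_binomial c3 (e - 1) (n - k)"
        using q_binomial_absorb[of "n - k" c3 e] that by (simp add: Suc_diff_le of_nat_diff algebra_simps)
      then show ?thesis
        by (simp add: U_def cf_def f_def algebra_simps)
    qed
    have "(\<Sum>k\<le>Suc n. U k) = (\<Sum>k\<le>n. U k)"
      by (simp add: U_def)
    also have "\<dots> = q_int cf f * q_int c3 e *
        (q_rising (c2 - c3) (b - (e - 1)) n * q_binomial (c1 + c3) (a + (e - 1)) n)"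
      unfolding Suc.IH[symmetric] sum_distrib_left using U by (intro sum.cong) auto
    finally show ?thesis
      by (simp add: algebra_simps)
  qed
  have sum_V: "(\<Sum>k\<le>Suc n. V k) = q_int c1 a * q_int c2 b *
      (q_rising (c2 - c3) (b - e + 1) n * q_binomial (c1 + c3) (a + e - 1) n)"
  proof -
    have V: "V (Suc k) = q_int c1 a * q_int c2 b * (q_binomial c1 (a - 1) k *
        q_binomial c3 e (n - k) * q_rising c2 (b + 1) k *
        q_rising (c2 - c1 - c3) (b + 1 - (a - 1) - e + int k) (n - k))" for k
      unfolding V_def cf_def f_def q_rising_Suc_left[of c2 b k]
      using q_binomial_absorb[of k c1 a] by (simp add: algebra_simps)
    have "(\<Sum>k\<le>Suc n. V k) = (\<Sum>k\<le>n. V (Suc k))"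
      unfolding sum.atMost_Suc_shift by (simp add: V_def)
    also have "\<dots> = q_int c1 a * q_int c2 b *
        (q_rising (c2 - c3) (b + 1 - e) n * q_binomial (c1 + c3) (a - 1 + e) n)"
      unfolding Suc.IH[symmetric] sum_distrib_left using V by (intro sum.cong) auto
    finally show ?thesis
      by (simp add: algebra_simps)
  qed
  have "q_int 0 (int (Suc n)) * (\<Sum>k\<le>Suc n. ?B k * q_rising cf (f + int k) (Suc n - k))
      = (\<Sum>k\<le>Suc n. U k) + (\<Sum>k\<le>Suc n. V k)"
    unfolding sum_distrib_left sum.distrib[symmetric] using term_split by (intro sum.cong) auto
  also have "\<dots> = (q_int cf f * q_int c3 e + q_int c1 a * q_int c2 b) *
      (q_rising (c2 - c3) (b - e + 1) n * q_binomial (c1 + c3) (a + e - 1) n)"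
    unfolding sum_U sum_V by (simp only: distrib_right)
  also have "q_int cf f * q_int c3 e + q_int c1 a * q_int c2 b
      = q_int (c2 - c3) (b - e) * q_int (c1 + c3) (a + e)"
    unfolding mult.commute[of "q_int c1 a" "q_int c2 b"] unfolding q_int_mult by (simp add: cf_def f_def algebra_simps)
  also have "\<dots> * (q_rising (c2 - c3) (b - e + 1) n * q_binomial (c1 + c3) (a + e - 1) n)
      = q_rising (c2 - c3) (b - e) (Suc n) *
        (q_int (c1 + c3) (a + e) * q_binomial (c1 + c3) (a + e - 1) n)"
    unfolding q_rising_Suc_left by (simp only: mult_ac)
  also have "\<dots> = q_int 0 (int (Suc n)) *
      (q_rising (c2 - c3) (b - e) (Suc n) * q_binomial (c1 + c3) (a + e) (Suc n))"
    unfolding q_binomial_absorb[symmetric] by (simp only: mult_ac)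
  finally show ?case
    using q_int_nat_nonzero[of "Suc n"] by (simp only: f_def cf_def) simp
qed

text \<open>
  This is the case \<open>b - a - e = 2\<close>, where the last rising factorial becomes a quotient of
  factorials, \<open>[n + 1]!/[i + 1]!\<close>, and produces the denominator \<open>[i + 1]\<close>.
\<close>

lemma q_binomial_sum:
  "(\<Sum>i\<le>n. q_binomial c (x - 1) i * q_binomial (c + c') (x + e + int i) i *
       q_binomial c' e (n - i) / q_int 0 (int (Suc i)))
   = q_binomial c (x + int n) n * q_binomial (c + c') (x + e - 1) n / q_int 0 (int (Suc n))"
proof -
  have summand: "q_binomial c (x - 1) i * q_binomial c' e (n - i) * q_rising (c + c') (x + e + 1) i *
       q_rising (c + c' - c - c') (x + e + 1 - (x - 1) - e + int i) (n - i)
     = q_fact (Suc n) * (q_binomial c (x - 1) i * q_binomial (c + c') (x + e + int i) i *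
       q_binomial c' e (n - i) / q_int 0 (int (Suc i)))" if "i \<le> n" for i
  proof -
    have "q_fact (Suc i) * q_rising 0 (2 + int i) (n - i) = q_fact (Suc n)"
      using q_fact_mult_q_rising[of "Suc i" "n - i"] that by (simp add: algebra_simps)
    then have "q_rising 0 (2 + int i) (n - i) = q_fact (Suc n) / (q_fact i * q_int 0 (int (Suc i)))"
      using q_fact_nonzero[of i] q_int_nat_nonzero[of "Suc i"]
      by (simp add: q_fact_Suc[of i] field_simps)
    moreover have "q_rising (c + c') (x + e + 1) i
        = q_fact i * q_binomial (c + c') (x + e + int i) i"
      unfolding q_rising_eq_q_binomial by (simp add: algebra_simps)
    ultimately show ?thesis
      using q_fact_nonzero[of i] by (simp add: add.commute)
  qed
  have "q_fact (Suc n) * (\<Sum>i\<le>n. q_binomial c (x - 1) i * q_binomial (c + c') (x + e + int i) i *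
       q_binomial c' e (n - i) / q_int 0 (int (Suc i)))
     = q_rising (c + c' - c') (x + e + 1 - e) n * q_binomial (c + c') (x - 1 + e) n"
    unfolding q_saalschuetz[symmetric] sum_distrib_left using summand by (intro sum.cong) auto
  also have "\<dots> = q_fact n * q_binomial c (x + int n) n * q_binomial (c + c') (x + e - 1) n"
    unfolding q_rising_eq_q_binomial by (simp add: algebra_simps)
  finally show ?thesis
    using q_fact_nonzero[of n] q_int_nat_nonzero[of "Suc n"]
    by (simp add: q_fact_Suc field_simps)
qed

section \<open>Partitions with a given number of parts\<close>

text \<open>
  The lists \<open>k\<close> and \<open>n\<close> hold the multiplicities and the sizes of the distinct parts of a partition of
  \<open>D\<close> with \<open>K\<close> parts. The empty partition is included, so that removing columns never leaves the
  family.
\<close>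

definition partitions_by_parts :: "nat \<Rightarrow> nat \<Rightarrow> (nat list \<times> nat list) set" where
  "partitions_by_parts D K = {(k, n). length k = length n \<and>
     (\<forall>x\<in>set k. x > 0) \<and> (\<forall>x\<in>set n. x > 0) \<and> sorted_wrt (>) n \<and>
     (\<Sum>i<length k. n ! i * k ! i) = D \<and> (\<Sum>i<length k. k ! i) = K}"

text \<open>
  The integer \<open>A\<close> is counted from the formal variable: the upper parameters are
  \<open>d\<^sub>2 + A + \<dots>\<close>, in accordance with the first argument 1 of \<open>q_binomial\<close>.
\<close>

definition weight :: "int \<Rightarrow> nat list \<times> nat list \<Rightarrow> ratfun" where
  "weight A = (\<lambda>(k, n). \<Prod>i<length k.
     q_binomial 1 (A + 2 * (\<Sum>j\<le>i. (int (n ! i) - int (n ! j)) * int (k ! j))) (k ! i))"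

text \<open>
  This prepends a column to a Young diagram such that exactly \<open>c\<close> parts equal to one are created. In
  the case \<open>c = 0\<close> no entry may be appended, since multiplicities are positive.
\<close>

definition add_column :: "nat \<Rightarrow> nat list \<times> nat list \<Rightarrow> nat list \<times> nat list" where
  "add_column c = (\<lambda>(k, n). if c = 0 then (k, map Suc n) else (k @ [c], map Suc n @ [1]))"

lemma index_set_eq:
  assumes "D > 0"
  shows "index_set D = (\<lambda>(k, n). (length k, k, n)) ` (\<Union>K\<in>{1..D}. partitions_by_parts D K)"
proof (intro equalityI subsetI)
  fix x assume "x \<in> index_set D"
  then obtain m k n where x: "x = (m, k, n)" and h: "m \<ge> 1" "length k = m" "length n = m"
    "\<forall>i<m. k ! i > 0" "\<forall>i<m. n ! i > 0" "\<forall>i j. i < j \<and> j < m \<longrightarrow> n ! i > n ! j"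
    "(\<Sum>i<m. n ! i * k ! i) = D"
    by (auto simp: index_set_def)
  have "(\<Sum>i<m. k ! i) \<le> (\<Sum>i<m. n ! i * k ! i)"
    using h by (intro sum_mono) (simp add: Suc_le_eq)
  moreover have "(\<Sum>i<m. k ! i) \<ge> 1"
    using h member_le_sum[of 0 "{..<m}" "(!) k"] by (simp add: Suc_le_eq) (metis Suc_le_eq le_zero_eq neq0_conv)
  ultimately have "(\<Sum>i<m. k ! i) \<in> {1..D}"
    using h by simp
  moreover have "(k, n) \<in> partitions_by_parts D (\<Sum>i<m. k ! i)"
    using h by (auto simp: partitions_by_parts_def all_set_conv_all_nth sorted_wrt_iff_nth_less)
  ultimately show "x \<in> (\<lambda>(k, n). (length k, k, n)) ` (\<Union>K\<in>{1..D}. partitions_by_parts D K)"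
    using x h by (intro image_eqI[of _ _ "(k, n)"]) auto
next
  fix x assume "x \<in> (\<lambda>(k, n). (length k, k, n)) ` (\<Union>K\<in>{1..D}. partitions_by_parts D K)"
  then obtain k n K where x: "x = (length k, k, n)" "(k, n) \<in> partitions_by_parts D K"
    by auto
  moreover from x assms have "length k \<ge> 1"
    by (cases k) (auto simp: partitions_by_parts_def)
  ultimately show "x \<in> index_set D"
    by (auto simp: partitions_by_parts_def index_set_def sorted_wrt_iff_nth_less)
qed

lemma finite_partitions_by_parts: "finite (partitions_by_parts D K)"
proof -
  have "(k, n) \<in> insert ([], []) (snd ` index_set D)" if "(k, n) \<in> partitions_by_parts D K" for k n
  proof (cases "k = []")
    case True
    then show ?thesis using that by (auto simp: partitions_by_parts_def)
  next
    case False
    then have "(length k, k, n) \<in> index_set D"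
      using that
      by (auto simp: partitions_by_parts_def index_set_def sorted_wrt_iff_nth_less Suc_le_eq)
    then show ?thesis by force
  qed
  then have "partitions_by_parts D K \<subseteq> insert ([], []) (snd ` index_set D)"
    by auto
  then show ?thesis
    using finite_index_set finite_subset by blast
qed

lemma partitions_by_parts_empty:
  assumes "D < K"
  shows "partitions_by_parts D K = {}"
proof -
  have "(\<Sum>i<length k. k ! i) \<le> (\<Sum>i<length k. n ! i * k ! i)"
    if "length k = length n" "\<forall>x\<in>set n. x > 0" for k n :: "nat list"
    using that by (intro sum_mono) (auto simp: Suc_le_eq all_set_conv_all_nth)
  then show ?thesis
    using assms by (fastforce simp: partitions_by_parts_def)
qed

lemma no_parts:
  fixes k :: "nat list"
  assumes "(\<Sum>i<length k. k ! i) = 0" "\<forall>x\<in>set k. x > 0"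
  shows "k = []"
  using assms by (cases k) (auto simp: sum.lessThan_Suc_shift simp del: sum.lessThan_Suc)

lemma partitions_by_parts_0: "partitions_by_parts 0 0 = {([], [])}"
  by (auto simp: partitions_by_parts_def dest: no_parts simp del: sum_eq_0_iff)

lemma partitions_by_parts_no_parts:
  assumes "D > 0"
  shows "partitions_by_parts D 0 = {}"
proof -
  have False if "(k, n) \<in> partitions_by_parts D 0" for k n
  proof -
    have "k = []"
      using that unfolding partitions_by_parts_def mem_Collect_eq prod.case
      by (intro no_parts) blast+
    then show False
      using that assms by (simp add: partitions_by_parts_def)
  qed
  then show ?thesis by auto
qed

text \<open>
  Removing the first column of a Young diagram with \<open>K\<close> rows removes \<open>K\<close> boxes and exactly those rows
  that have length one; as the sizes decrease, these rows form the last entry of the lists.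
\<close>

lemma partitions_by_parts_rec:
  assumes "K > 0"
  shows "partitions_by_parts (N + K) K
    = (\<Union>c\<in>{..K}. add_column c ` partitions_by_parts N (K - c))"
proof (intro equalityI subsetI)
  fix x assume "x \<in> partitions_by_parts (N + K) K"
  moreover obtain k n where x: "x = (k, n)" by (cases x)
  ultimately have h: "length k = length n"
    "\<forall>x\<in>set k. x > 0" "\<forall>x\<in>set n. x > 0" "sorted_wrt (>) n"
    "(\<Sum>i<length k. n ! i * k ! i) = N + K" "(\<Sum>i<length k. k ! i) = K"
    unfolding partitions_by_parts_def by blast+
  show "x \<in> (\<Union>c\<in>{..K}. add_column c ` partitions_by_parts N (K - c))"
  proof (cases "1 \<in> set n")
    case False
    define n' where "n' = map (\<lambda>x. x - 1) n"
    have n: "n = map Suc n'"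
      using h(3) by (auto simp: n'_def intro!: map_idI[symmetric])
    have n'pos: "\<forall>x\<in>set n'. x > 0"
    proof
      fix x assume "x \<in> set n'"
      then have "Suc x \<in> set n" by (simp add: n)
      then show "x > 0" using False by (cases x) auto
    qed
    have "(\<Sum>i<length k. n ! i * k ! i) = (\<Sum>i<length k. n' ! i * k ! i) + (\<Sum>i<length k. k ! i)"
      using h(1) by (simp add: n sum.distrib[symmetric] add.commute)
    then have "(k, n') \<in> partitions_by_parts N (K - 0)"
      using h n'pos by (auto simp: partitions_by_parts_def n sorted_wrt_map)
    moreover have "x = add_column 0 (k, n')"
      by (simp add: add_column_def x n)
    ultimately show ?thesis by blast
  next
    case True
    then obtain us y where us: "n = us @ [y]"
      by (metis rev_exhaust empty_iff list.set(1))
    have y: "y = 1"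
      using True h(3,4) by (auto simp: us sorted_wrt_append)
    obtain ks c where ks: "k = ks @ [c]"
      using h(1) us by (metis rev_exhaust length_0_conv snoc_eq_iff_butlast)
    have gt: "\<forall>x\<in>set us. x > 1"
      using h(4) by (auto simp: us y sorted_wrt_append)
    define n' where "n' = map (\<lambda>x. x - 1) us"
    have n: "us = map Suc n'"
      using gt by (auto simp: n'_def intro!: map_idI[symmetric])
    have n'pos: "\<forall>x\<in>set n'. x > 0"
      using gt by (auto simp: n'_def)
    have len: "length ks = length us" using h(1) us ks by simp
    have c: "c > 0" using h(2) ks by simp
    have sK: "(\<Sum>i<length ks. ks ! i) + c = K"
      using h(6) by (simp add: ks nth_append)
    have "(\<Sum>i<length ks. us ! i * ks ! i) + c = N + K"
      using h(5) len by (simp add: ks us y nth_append)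
    moreover have "(\<Sum>i<length ks. us ! i * ks ! i)
        = (\<Sum>i<length ks. n' ! i * ks ! i) + (\<Sum>i<length ks. ks ! i)"
      using len by (simp add: n sum.distrib[symmetric] add.commute)
    ultimately have "(ks, n') \<in> partitions_by_parts N (K - c)"
      using h n'pos len sK
      by (auto simp: partitions_by_parts_def n us ks sorted_wrt_map sorted_wrt_append)
    moreover have "x = add_column c (ks, n')"
      using c by (simp add: add_column_def x n us ks y)
    moreover have "c \<in> {..K}" using sK by simp
    ultimately show ?thesis by blast
  qed
next
  fix x assume "x \<in> (\<Union>c\<in>{..K}. add_column c ` partitions_by_parts N (K - c))"
  then obtain c k n where c: "c \<le> K" and x: "x = add_column c (k, n)"
    and kn: "(k, n) \<in> partitions_by_parts N (K - c)"
    by auto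
  have "(\<Sum>i<length k. Suc (n ! i) * k ! i)
      = (\<Sum>i<length k. n ! i * k ! i) + (\<Sum>i<length k. k ! i)"
    by (simp add: sum.distrib[symmetric] add.commute)
  then show "x \<in> partitions_by_parts (N + K) K"
    using kn c
    by (auto simp: x add_column_def partitions_by_parts_def sorted_wrt_map sorted_wrt_append
        nth_append)
qed

lemma inj_on_add_column: "inj_on (add_column c) S"
  by (auto simp: inj_on_def add_column_def inj_map_eq_map split: if_splits)

lemma add_column_disjoint:
  assumes "c \<noteq> c'"
  shows "add_column c ` partitions_by_parts N K \<inter> add_column c' ` partitions_by_parts N' K' = {}"
proof -
  have "False" if "add_column c (k, n) = add_column c' (k', n')"
    "(k, n) \<in> partitions_by_parts N K" "(k', n') \<in> partitions_by_parts N' K'" for k n k' n'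
  proof -
    have "1 \<notin> Suc ` set n" "1 \<notin> Suc ` set n'"
      using that by (auto simp: partitions_by_parts_def)
    moreover have "1 \<in> Suc ` set n \<or> 1 \<in> Suc ` set n'"
    proof (cases "c = 0 \<or> c' = 0")
      case True
      then have "map Suc n = map Suc n' @ [1] \<or> map Suc n @ [1] = map Suc n'"
        using that(1) assms by (auto simp: add_column_def)
      then have "1 \<in> set (map Suc n) \<or> 1 \<in> set (map Suc n')"
        by (metis in_set_conv_decomp)
      then show ?thesis by simp
    next
      case False
      then show ?thesis using that(1) assms by (simp add: add_column_def)
    qed
    ultimately show False by blast
  qed
  then show ?thesis by fastforce
qed

text \<open>
  Raising all parts by one preserves the differences \<open>n\<^sub>i - n\<^sub>j\<close>, hence all previous factors. In the
  new factor the difference between one and a raised part is the negative of the original part, so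
  that the sum over \<open>j\<close> collapses to \<open>-N\<close>.
\<close>

lemma weight_add_column:
  assumes "(k, n) \<in> partitions_by_parts N K"
  shows "weight A (add_column c (k, n)) = q_binomial 1 (A - 2 * int N) c * weight A (k, n)"
proof -
  have len: "length k = length n" and N: "(\<Sum>i<length k. n ! i * k ! i) = N"
    using assms by (auto simp: partitions_by_parts_def)
  show ?thesis
  proof (cases "c = 0")
    case True
    then show ?thesis
      using len by (auto simp: weight_def add_column_def intro!: prod.cong sum.cong arg_cong2[where f = "q_binomial 1"])
  next
    case False
    have "int N = (\<Sum>i<length k. int (n ! i) * int (k ! i))"
      unfolding N[symmetric] by simp
    then have last: "(\<Sum>j<length k. (1 - int (Suc (n ! j))) * int (k ! j)) = - int N"
      by (simp add: sum_negf)
    have "weight A (add_column c (k, n)) = weight A (k, n) *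
       q_binomial 1 (A + 2 * (\<Sum>j<length k. (1 - int (Suc (n ! j))) * int (k ! j))) c"
      using len False
      by (auto simp: weight_def add_column_def nth_append lessThan_Suc_atMost[symmetric]
          intro!: arg_cong2[where f = "(*)"] arg_cong2[where f = "q_binomial 1"] prod.cong sum.cong)
    then show ?thesis
      unfolding last by (simp add: mult.commute)
  qed
qed

lemma sum_weight_rec:
  assumes "K > 0"
  shows "sum (weight A) (partitions_by_parts (N + K) K)
    = (\<Sum>c\<le>K. q_binomial 1 (A - 2 * int N) c * sum (weight A) (partitions_by_parts N (K - c)))"
proof -
  have "sum (weight A) (partitions_by_parts (N + K) K)
      = (\<Sum>c\<le>K. sum (weight A) (add_column c ` partitions_by_parts N (K - c)))"
    unfolding partitions_by_parts_rec[OF assms]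
    using finite_partitions_by_parts add_column_disjoint by (intro sum.UNION_disjoint) auto
  also have "\<dots> = (\<Sum>c\<le>K. q_binomial 1 (A - 2 * int N) c * sum (weight A) (partitions_by_parts N (K - c)))"
    unfolding sum.reindex[OF inj_on_add_column] sum_distrib_left
    using weight_add_column by (intro sum.cong refl) auto
  finally show ?thesis .
qed

text \<open>
  If \<open>D < K\<close>, both sides vanish. If \<open>D = K\<close>, all parts are equal to one and only the term
  \<open>c = K\<close> of the recursion survives. If \<open>D > K\<close>, the recursion leads to smaller diagrams with at
  least one box, and the convolution is summed by \<open>q_binomial_sum\<close> with \<open>x = D - K\<close> and
  \<open>e = d\<^sub>2 + A - 2(D - K)\<close>.
\<close>

lemma sum_weight:
  assumes "D > 0" "K > 0"
  shows "sum (weight A) (partitions_by_parts D K) = q_int 1 A / q_int 0 (int K) *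
    q_binomial 0 (int D - 1) (K - 1) * q_binomial 1 (A - int D + int K - 1) (K - 1)"
  using assms
proof (induction D arbitrary: K rule: less_induct)
  case (less D)
  consider "D < K" | "D = K" | "D > K" by linarith
  then show ?case
  proof cases
    case 1
    have "q_binomial 0 (int (D - 1)) (K - 1) = 0"
      using 1 less.prems by (intro q_binomial_eq_0) linarith
    then show ?thesis
      using 1 less.prems by (simp add: partitions_by_parts_empty of_nat_diff)
  next
    case 2
    obtain K' where K': "K = Suc K'" using less.prems by (cases K) auto
    have "sum (weight A) (partitions_by_parts (0 + K) K)
        = (\<Sum>c\<le>K. q_binomial 1 A c * sum (weight A) (partitions_by_parts 0 (K - c)))"
      using sum_weight_rec[of K A 0] less.prems by simp
    also have "\<dots> = (\<Sum>c\<in>{K}. q_binomial 1 A c * sum (weight A) (partitions_by_parts 0 (K - c)))"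
      by (intro sum.mono_neutral_right) (auto simp: partitions_by_parts_empty)
    also have "\<dots> = q_binomial 1 A K"
      by (simp add: partitions_by_parts_0 weight_def)
    finally show ?thesis
      using 2 q_binomial_absorb[of K' 1 A] q_int_nat_nonzero[of K] q_binomial_eq_q_fact[of K' K'] q_fact_nonzero[of K']
      by (simp add: K' field_simps)
  next
    case 3
    define N where "N = D - K"
    have D: "D = N + K" and N: "N > 0" "N < D" using 3 less.prems by (auto simp: N_def)
    obtain n where n: "K = Suc n" using less.prems by (cases K) auto
    have "sum (weight A) (partitions_by_parts D K)
        = (\<Sum>c\<le>Suc n. q_binomial 1 (A - 2 * int N) c * sum (weight A) (partitions_by_parts N (Suc n - c)))"
      unfolding D n by (intro sum_weight_rec) simp
    also have "\<dots> = (\<Sum>c\<le>n. q_binomial 1 (A - 2 * int N) c * sum (weight A) (partitions_by_parts N (Suc (n - c))))"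
      using N by (simp add: partitions_by_parts_no_parts Suc_diff_le)
    also have "\<dots> = (\<Sum>i\<le>n. q_binomial 1 (A - 2 * int N) (n - i) * sum (weight A) (partitions_by_parts N (Suc i)))"
      by (rule sum.reindex_bij_witness[where i = "\<lambda>i. n - i" and j = "\<lambda>i. n - i"]) auto
    also have "\<dots> = q_int 1 A * (\<Sum>i\<le>n. q_binomial 0 (int N - 1) i *
        q_binomial (0 + 1) (int N + (A - 2 * int N) + int i) i *
        q_binomial 1 (A - 2 * int N) (n - i) / q_int 0 (int (Suc i)))"
      unfolding sum_distrib_left[of "q_int 1 A"]
    proof (intro sum.cong refl)
      fix i
      have "sum (weight A) (partitions_by_parts N (Suc i)) = q_int 1 A / q_int 0 (int (Suc i)) *
          q_binomial 0 (int N - 1) i * q_binomial 1 (A - int N + int i) i"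
        using less.IH[of N "Suc i"] N by (simp add: algebra_simps)
      then show "q_binomial 1 (A - 2 * int N) (n - i) * sum (weight A) (partitions_by_parts N (Suc i))
        = q_int 1 A * (q_binomial 0 (int N - 1) i *
        q_binomial (0 + 1) (int N + (A - 2 * int N) + int i) i *
        q_binomial 1 (A - 2 * int N) (n - i) / q_int 0 (int (Suc i)))"
        by (simp add: algebra_simps)
    qed
    also have "\<dots> = q_int 1 A / q_int 0 (int K) *
        q_binomial 0 (int D - 1) (K - 1) * q_binomial 1 (A - int D + int K - 1) (K - 1)"
      unfolding q_binomial_sum by (simp add: D n algebra_simps)
    finally show ?thesis .
  qed
qed

section \<open>The multisum\<close>

theorem theorem2:
  fixes d1 :: nat
  assumes "d1 > 0"
  shows
    "(\<Sum>(m, k, n)\<in>index_set d1.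
        q_binomial 1 0 (\<Sum>j<m. k ! j) *
        (\<Prod>i<m. q_binomial 1
           (2 * int d1 + 2 * (\<Sum>j\<le>i. (int (n ! i) - int (n ! j)) * int (k ! j))) (k ! i)))
     = q_int 1 (2 * int d1) / q_int 1 0 * (q_binomial 1 (int d1 - 1) d1)\<^sup>2"
    (is "sum ?t _ = _")
proof -
  obtain n where n: "d1 = Suc n" using assms by (cases d1) auto
  have inj: "inj_on (\<lambda>(k, n). (length k, k, n)) S" for S :: "(nat list \<times> nat list) set"
    by (auto simp: inj_on_def)
  have "sum ?t (index_set d1) = (\<Sum>p\<in>(\<Union>K\<in>{1..d1}. partitions_by_parts d1 K).
      q_binomial 1 0 (\<Sum>j<length (fst p). fst p ! j) * weight (2 * int d1) p)"
    unfolding index_set_eq[OF assms] sum.reindex[OF inj]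
    by (intro sum.cong refl) (auto simp: weight_def)
  also have "\<dots> = (\<Sum>K\<in>{1..d1}. \<Sum>p\<in>partitions_by_parts d1 K.
      q_binomial 1 0 (\<Sum>j<length (fst p). fst p ! j) * weight (2 * int d1) p)"
    using finite_partitions_by_parts
    by (intro sum.UNION_disjoint) (auto simp: partitions_by_parts_def)
  also have "\<dots> = (\<Sum>K\<in>{1..d1}. q_binomial 1 0 K * sum (weight (2 * int d1)) (partitions_by_parts d1 K))"
    unfolding sum_distrib_left by (intro sum.cong refl) (auto simp: partitions_by_parts_def)
  also have "\<dots> = (\<Sum>i\<le>n. q_binomial 1 0 (Suc i) *
      sum (weight (2 * int d1)) (partitions_by_parts d1 (Suc i)))"
    by (rule sum.reindex_bij_witness[where i = Suc and j = "\<lambda>K. K - 1"]) (auto simp: n)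
  also have "\<dots> = q_int 1 (2 * int d1) * q_int 1 0 / q_int 0 (int d1) *
      (\<Sum>i\<le>n. q_binomial 1 (0 - 1) i * q_binomial (1 + 0) (0 + int d1 + int i) i *
        q_binomial 0 (int d1) (n - i) / q_int 0 (int (Suc i)))"
    unfolding sum_distrib_left[of "q_int 1 (2 * int d1) * q_int 1 0 / q_int 0 (int d1)"]
  proof (intro sum.cong refl)
    fix i assume "i \<in> {..n}"
    \<comment> \<open>To reach the form of \<open>q_binomial_sum\<close> with \<open>x = d\<^sub>2\<close> and \<open>e = d\<^sub>1\<close>, absorption replaces
      \<open>binom(d\<^sub>2, i + 1)\<close> by \<open>binom(d\<^sub>2 - 1, i)\<close> and \<open>binom(d\<^sub>1 - 1, i)\<close> by \<open>binom(d\<^sub>1, i + 1)\<close>, and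
      the latter equals \<open>binom(d\<^sub>1, n - i)\<close> by symmetry.\<close>
    show "q_binomial 1 0 (Suc i) * sum (weight (2 * int d1)) (partitions_by_parts d1 (Suc i))
      = q_int 1 (2 * int d1) * q_int 1 0 / q_int 0 (int d1) *
      (q_binomial 1 (0 - 1) i * q_binomial (1 + 0) (0 + int d1 + int i) i *
        q_binomial 0 (int d1) (n - i) / q_int 0 (int (Suc i)))"
    proof -
      have "q_binomial 0 (int d1) (n - i) = q_binomial 0 (int d1) (Suc i)"
        using \<open>i \<in> {..n}\<close> by (simp add: n q_binomial_eq_q_fact Suc_diff_le mult.commute del: of_nat_Suc)
      then have "q_binomial 0 (int d1 - 1) i
          = q_int 0 (int (Suc i)) * q_binomial 0 (int d1) (n - i) / q_int 0 (int d1)"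
        using q_binomial_absorb[of i 0 "int d1"] q_int_nat_nonzero[OF assms]
        by (simp add: field_simps)
      moreover have "q_binomial 1 0 (Suc i) = q_int 1 0 * q_binomial 1 (0 - 1) i / q_int 0 (int (Suc i))"
        using q_binomial_absorb[of i 1 0] q_int_nat_nonzero[of "Suc i"] by (simp add: field_simps)
      moreover have "sum (weight (2 * int d1)) (partitions_by_parts d1 (Suc i))
          = q_int 1 (2 * int d1) / q_int 0 (int (Suc i)) * q_binomial 0 (int d1 - 1) i *
            q_binomial 1 (int d1 + int i) i"
        using sum_weight[of d1 "Suc i" "2 * int d1"] assms by (simp add: algebra_simps)
      ultimately show ?thesis
        using q_int_nat_nonzero[of "Suc i"] by (simp add: mult_ac del: of_nat_Suc)
    qed
  qed
  also have "\<dots> = q_int 1 (2 * int d1) * q_int 1 0 / q_int 0 (int d1) *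
     (q_binomial 1 (int n) n * q_binomial 1 (int n) n / q_int 0 (int d1))"
    unfolding q_binomial_sum by (simp add: n)
  also have "\<dots> = q_int 1 (2 * int d1) / q_int 1 0 * (q_binomial 1 (int d1 - 1) d1)\<^sup>2"
  proof -
    have "q_binomial 1 (int d1 - 1) d1 = q_int 1 0 / q_int 0 (int d1) * q_binomial 1 (int n) n"
      using q_binomial_Suc[of n 1 "int n"] q_int_nat_nonzero[of d1]
      by (simp add: n field_simps)
    then show ?thesis
      by (simp add: power2_eq_square)
  qed
  finally show ?thesis .
qed

end
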